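(* Let $(M_1,J_1)$ and $(M_2,J_2)$ be connected metallic manifolds, with $J_i^2=p_iJ_i+q_iI$, $p_i,q_i\in\mathbb{R}$, $i=1,2$, and let $f:(M_1,J_1)\to(M_2,J_2)$ be a metallic map. If $p_1\neq p_2$ and $$\frac{q_1-q_2}{p_2-p_1}\neq\frac{p_2\pm\sqrt{p_2^2+4q_2}}{2}$$ (for both choices of sign), then $f$ is constant. Moreover, if $p_1=p_2$ but $q_1\neq q_2$, then $f$ is constant.
   Context: A metallic manifold $(M,J)$ is a smooth manifold with a $(1,1)$-tensor field $J$ satisfying $J^2=pJ+qI$ for fixed real numbers $p,q$, where $I$ is the identity. A smooth map $f:(M_1,J_1)\to(M_2,J_2)$ is a metallic map if $f_*\circ J_1=J_2\circ f_*$, where $f_*$ is the tangent map of $f$. If $p_2^2+4q_2<0$ the square root is understood in $\mathbb{C}$, so that the displayed condition holds automatically. *)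

theory Defs
  imports "HOL-Analysis.Analysis"
begin

text \<open>
  \<open>C\<^sup>k\<close> and smooth maps on an open subset of a finite-dimensional space: all iterated
  directional derivatives exist and are continuous.
\<close>

primrec Ck_on :: "nat \<Rightarrow> ('a::real_normed_vector \<Rightarrow> 'b::real_normed_vector) \<Rightarrow> 'a set \<Rightarrow> bool" where
  "Ck_on 0 f S \<longleftrightarrow> continuous_on S f"
| "Ck_on (Suc k) f S \<longleftrightarrow> (\<forall>x\<in>S. f differentiable (at x)) \<and>
     (\<forall>v. Ck_on k (\<lambda>x. frechet_derivative f (at x) v) S)"

definition smooth_on :: "('a::real_normed_vector \<Rightarrow> 'b::real_normed_vector) \<Rightarrow> 'a set \<Rightarrow> bool" where
  "smooth_on f S \<longleftrightarrow> (\<forall>k. Ck_on k f S)"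

text \<open>
  A smooth manifold is a Hausdorff, second countable space with a smooth atlas \<open>A\<close> of charts
  \<open>(U, \<phi>)\<close>, not required to be maximal.  The model space is a finite-dimensional real inner
  product space; the class \<open>euclidean_space\<close> is not used because it excludes dimension zero.
  The values of a chart map outside its domain are irrelevant.
\<close>

type_synonym ('a, 'b) chart = "'a set \<times> ('a \<Rightarrow> 'b)"

locale smooth_manifold =
  fixes M :: "'a topology" and A :: "('a, 'b::real_inner) chart set"
  assumes finite_dimensional_model: "\<exists>B::'b set. finite B \<and> span B = UNIV"
    and Hausdorff: "Hausdorff_space M"
    and second_countable: "second_countable M"
    and charts_cover: "(\<Union>(U, \<phi>)\<in>A. U) = topspace M"
    and chart_domain: "\<And>U \<phi>. (U, \<phi>) \<in> A \<Longrightarrow> openin M U"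
    and chart_image: "\<And>U \<phi>. (U, \<phi>) \<in> A \<Longrightarrow> open (\<phi> ` U)"
    and chart_homeo: "\<And>U \<phi>. (U, \<phi>) \<in> A \<Longrightarrow>
          homeomorphic_map (subtopology M U) (top_of_set (\<phi> ` U)) \<phi>"
    and charts_compatible: "\<And>U \<phi> V \<psi>. (U, \<phi>) \<in> A \<Longrightarrow> (V, \<psi>) \<in> A \<Longrightarrow>
          smooth_on (\<psi> \<circ> inv_into U \<phi>) (\<phi> ` (U \<inter> V))"

definition smooth_function_on ::
    "'a topology \<Rightarrow> ('a, 'b::real_inner) chart set \<Rightarrow> 'a set \<Rightarrow> ('a \<Rightarrow> real) \<Rightarrow> bool" where
  "smooth_function_on M A W g \<longleftrightarrow> openin M W \<and>
     (\<forall>(U, \<phi>)\<in>A. smooth_on (g \<circ> inv_into U \<phi>) (\<phi> ` (U \<inter> W)))"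

definition smooth_near ::
    "'a topology \<Rightarrow> ('a, 'b::real_inner) chart set \<Rightarrow> 'a \<Rightarrow> ('a \<Rightarrow> real) \<Rightarrow> bool" where
  "smooth_near M A x g \<longleftrightarrow> (\<exists>W. x \<in> W \<and> smooth_function_on M A W g)"

definition smooth_map ::
    "'a topology \<Rightarrow> ('a, 'b::real_inner) chart set \<Rightarrow> 'c topology \<Rightarrow> ('c, 'd::real_inner) chart set
      \<Rightarrow> ('a \<Rightarrow> 'c) \<Rightarrow> bool" where
  "smooth_map M A N B f \<longleftrightarrow> continuous_map M N f \<and>
     (\<forall>(U, \<phi>)\<in>A. \<forall>(V, \<psi>)\<in>B. smooth_on (\<psi> \<circ> f \<circ> inv_into U \<phi>) (\<phi> ` (U \<inter> f -` V)))"

text \<open>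
  Tangent vectors at \<open>x\<close> are the derivations at \<open>x\<close> of real functions that are smooth near \<open>x\<close>.
  The functions are total on the type, but the Leibniz rule (take \<open>h\<close> to be the indicator of the
  complement of a neighbourhood of \<open>x\<close>) makes a derivation depend on the germ of its argument
  only.  The value \<open>0\<close> on functions that are not smooth near \<open>x\<close> is a convention that makes
  equality of tangent vectors equality of functions.
\<close>

type_synonym 'a tangent_vector = "('a \<Rightarrow> real) \<Rightarrow> real"

definition tangent_space ::
    "'a topology \<Rightarrow> ('a, 'b::real_inner) chart set \<Rightarrow> 'a \<Rightarrow> 'a tangent_vector set" where
  "tangent_space M A x = {X.
     (\<forall>g h. smooth_near M A x g \<longrightarrow> smooth_near M A x h \<longrightarrow>
        X (\<lambda>y. g y + h y) = X g + X h \<and>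
        X (\<lambda>y. g y * h y) = X g * h x + g x * X h) \<and>
     (\<forall>c g. smooth_near M A x g \<longrightarrow> X (\<lambda>y. c * g y) = c * X g) \<and>
     (\<forall>g. \<not> smooth_near M A x g \<longrightarrow> X g = 0)}"

text \<open>The tangent map \<open>f\<^sub>*\<close> at \<open>x\<close>, from the tangent space at \<open>x\<close> to the one at \<open>f x\<close>.\<close>

definition tangent_map ::
    "'c topology \<Rightarrow> ('c, 'd::real_inner) chart set \<Rightarrow> ('a \<Rightarrow> 'c) \<Rightarrow> 'a
      \<Rightarrow> 'a tangent_vector \<Rightarrow> 'c tangent_vector" where
  "tangent_map N B f x X = (\<lambda>g. if smooth_near N B (f x) g then X (g \<circ> f) else 0)"

definition smooth_vector_field_on ::
    "'a topology \<Rightarrow> ('a, 'b::real_inner) chart set \<Rightarrow> 'a set \<Rightarrow> ('a \<Rightarrow> 'a tangent_vector) \<Rightarrow> bool" where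
  "smooth_vector_field_on M A W X \<longleftrightarrow> openin M W \<and> (\<forall>x\<in>W. X x \<in> tangent_space M A x) \<and>
     (\<forall>V g. V \<subseteq> W \<longrightarrow> smooth_function_on M A V g \<longrightarrow> smooth_function_on M A V (\<lambda>x. X x g))"

text \<open>
  A smooth (1,1)-tensor field is a field of linear endomorphisms of the tangent spaces that maps
  smooth (locally defined) vector fields to smooth vector fields.
\<close>

definition smooth_endomorphism_field ::
    "'a topology \<Rightarrow> ('a, 'b::real_inner) chart set
      \<Rightarrow> ('a \<Rightarrow> 'a tangent_vector \<Rightarrow> 'a tangent_vector) \<Rightarrow> bool" where
  "smooth_endomorphism_field M A J \<longleftrightarrow>
     (\<forall>x\<in>topspace M.
        (\<forall>X\<in>tangent_space M A x. J x X \<in> tangent_space M A x) \<and>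
        (\<forall>X\<in>tangent_space M A x. \<forall>Y\<in>tangent_space M A x. \<forall>a b.
           J x (\<lambda>g. a * X g + b * Y g) = (\<lambda>g. a * J x X g + b * J x Y g))) \<and>
     (\<forall>W X. smooth_vector_field_on M A W X \<longrightarrow> smooth_vector_field_on M A W (\<lambda>x. J x (X x)))"

definition metallic_manifold ::
    "'a topology \<Rightarrow> ('a, 'b::real_inner) chart set
      \<Rightarrow> ('a \<Rightarrow> 'a tangent_vector \<Rightarrow> 'a tangent_vector) \<Rightarrow> real \<Rightarrow> real \<Rightarrow> bool" where
  "metallic_manifold M A J p q \<longleftrightarrow>
     smooth_manifold M A \<and> smooth_endomorphism_field M A J \<and>
     (\<forall>x\<in>topspace M. \<forall>X\<in>tangent_space M A x. J x (J x X) = (\<lambda>g. p * J x X g + q * X g))"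

definition metallic_map ::
    "'a topology \<Rightarrow> ('a, 'b::real_inner) chart set
      \<Rightarrow> ('a \<Rightarrow> 'a tangent_vector \<Rightarrow> 'a tangent_vector)
      \<Rightarrow> 'c topology \<Rightarrow> ('c, 'd::real_inner) chart set
      \<Rightarrow> ('c \<Rightarrow> 'c tangent_vector \<Rightarrow> 'c tangent_vector)
      \<Rightarrow> ('a \<Rightarrow> 'c) \<Rightarrow> bool" where
  "metallic_map M A J N B K f \<longleftrightarrow> smooth_map M A N B f \<and>
     (\<forall>x\<in>topspace M. \<forall>X\<in>tangent_space M A x.
        tangent_map N B f x (J x X) = K (f x) (tangent_map N B f x X))"

end

theory Submission
  imports Defs
begin

text \<open>
  Put \<open>Y = f\<^sub>* X\<close>.  Applying \<open>f\<^sub>*\<close> to \<open>J\<^sub>1\<^sup>2 X = p\<^sub>1 J\<^sub>1 X + q\<^sub>1 X\<close> and comparing with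
  \<open>J\<^sub>2\<^sup>2 Y = p\<^sub>2 J\<^sub>2 Y + q\<^sub>2 Y\<close> gives \<open>(p\<^sub>1 - p\<^sub>2) J\<^sub>2 Y = (q\<^sub>2 - q\<^sub>1) Y\<close>.  If \<open>p\<^sub>1 = p\<^sub>2\<close> then
  \<open>Y = 0\<close>; otherwise a nonzero \<open>Y\<close> is an eigenvector of \<open>J\<^sub>2\<close> whose eigenvalue must be a root of
  \<open>t\<^sup>2 = p\<^sub>2 t + q\<^sub>2\<close>, which is excluded.  So \<open>f\<^sub>* = 0\<close>; testing this on the derivations along
  coordinate directions shows that \<open>f\<close> is locally constant in charts.
\<close>

section \<open>Calculus of \<open>C\<^sup>k\<close> maps\<close>

text \<open>Openness of \<open>S\<close> is essential: the derivatives are taken at a point in the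
  full space, so agreement on \<open>S\<close> passes to them only when \<open>S\<close> is a
  neighbourhood of each of its points.\<close>

lemma Ck_on_cong:
  assumes "open S" "Ck_on k f S" "\<And>x. x \<in> S \<Longrightarrow> f x = g x"
  shows "Ck_on k g S"
  using assms(2,3)
proof (induction k arbitrary: f g)
  case 0
  then show ?case by (metis Ck_on.simps(1) continuous_on_cong)
next
  case (Suc k)
  have D: "(g has_derivative frechet_derivative f (at x)) (at x)" if "x \<in> S" for x
  proof (rule has_derivative_transform_within_open)
    show "(f has_derivative frechet_derivative f (at x)) (at x)"
      using Suc.prems(1) that by (simp add: frechet_derivative_works)
  qed (use assms(1) that Suc.prems in auto)
  have "Ck_on k (\<lambda>x. frechet_derivative g (at x) v) S" for v
  proof (rule Suc.IH)
    show "Ck_on k (\<lambda>x. frechet_derivative f (at x) v) S" using Suc.prems(1) by simp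
  qed (metis D frechet_derivative_at)
  with D show ?case by (auto simp: differentiable_def)
qed

lemma Ck_on_subset:
  assumes "Ck_on k f S" "T \<subseteq> S"
  shows "Ck_on k f T"
  using assms by (induction k arbitrary: f) (auto intro: continuous_on_subset)

text \<open>Lets smoothness be checked with a different target chart near each point; the
  neighbourhoods found for \<open>f\<close> also serve for its directional derivatives.\<close>

lemma Ck_on_local:
  assumes "\<And>x. x \<in> S \<Longrightarrow> \<exists>T. open T \<and> x \<in> T \<and> Ck_on k f T"
  shows "Ck_on k f S"
  using assms
proof (induction k arbitrary: f)
  case 0
  then have "isCont f x" if "x \<in> S" for x
    using that continuous_on_eq_continuous_at by (metis Ck_on.simps(1))
  then show ?case by (simp add: continuous_at_imp_continuous_on)
next
  case (Suc k)
  have "f differentiable at x" if "x \<in> S" for x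
    using Suc.prems[OF that] by auto
  moreover have "Ck_on k (\<lambda>x. frechet_derivative f (at x) v) S" for v
    by (rule Suc.IH) (use Suc.prems in fastforce)
  ultimately show ?case by simp
qed

lemma Ck_on_Suc_imp: "Ck_on (Suc k) f S \<Longrightarrow> Ck_on k f S"
proof (induction k arbitrary: f)
  case 0
  then show ?case
    by (auto intro!: continuous_at_imp_continuous_on differentiable_imp_continuous_within)
qed auto

lemma Ck_on_const: "Ck_on k (\<lambda>_. c) S"
  by (induction k arbitrary: c) auto

section \<open>Sums, bounded linear and bounded bilinear images of \<open>Ck_on\<close> maps\<close>

lemma Ck_on_Suc_has_derivative:
  assumes "Ck_on (Suc k) f S" "x \<in> S"
  shows "(f has_derivative frechet_derivative f (at x)) (at x)"
  using assms by (simp add: frechet_derivative_works)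

text \<open>By uniqueness of the Frechet derivative, any explicit formula \<open>D\<close> may
  replace \<open>frechet_derivative\<close>, so the classical rules of differentiation can be fed in
  directly.\<close>

lemma Ck_on_SucI:
  assumes "open S" "\<And>x. x \<in> S \<Longrightarrow> (f has_derivative D x) (at x)"
    and "\<And>v. Ck_on k (\<lambda>x. D x v) S"
  shows "Ck_on (Suc k) f S"
proof -
  have "Ck_on k (\<lambda>x. frechet_derivative f (at x) v) S" for v
    by (rule Ck_on_cong[OF assms(1,3)])
      (simp add: frechet_derivative_at[OF assms(2), symmetric])
  then show ?thesis using assms(2) by (auto simp: differentiable_def)
qed

lemma Ck_on_bounded_linear:
  assumes "bounded_linear L" "open S" "Ck_on k f S"
  shows "Ck_on k (\<lambda>x. L (f x)) S"
  using assms(3)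
proof (induction k arbitrary: f)
  case 0
  then show ?case using bounded_linear.continuous_on[OF assms(1)] by simp
next
  case (Suc k)
  show ?case
  proof (rule Ck_on_SucI[OF assms(2)])
    show "((\<lambda>x. L (f x)) has_derivative (\<lambda>v. L (frechet_derivative f (at x) v))) (at x)"
      if "x \<in> S" for x
      by (rule bounded_linear.has_derivative[OF assms(1) Ck_on_Suc_has_derivative[OF Suc.prems that]])
    show "Ck_on k (\<lambda>x. L (frechet_derivative f (at x) v)) S" for v
      by (rule Suc.IH) (use Suc.prems in simp)
  qed
qed

lemma Ck_on_add:
  assumes "open S" "Ck_on k f S" "Ck_on k g S"
  shows "Ck_on k (\<lambda>x. f x + g x) S"
  using assms(2,3)
proof (induction k arbitrary: f g)
  case 0
  then show ?case by (simp add: continuous_on_add)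
next
  case (Suc k)
  show ?case
  proof (rule Ck_on_SucI[OF assms(1)])
    show "((\<lambda>x. f x + g x) has_derivative
        (\<lambda>v. frechet_derivative f (at x) v + frechet_derivative g (at x) v)) (at x)"
      if "x \<in> S" for x
      using Suc.prems that by (intro has_derivative_add Ck_on_Suc_has_derivative)
    show "Ck_on k (\<lambda>x. frechet_derivative f (at x) v + frechet_derivative g (at x) v) S" for v
      by (rule Suc.IH) (use Suc.prems in auto)
  qed
qed

lemma Ck_on_sum:
  assumes "open S" "\<And>i. i \<in> I \<Longrightarrow> Ck_on k (f i) S"
  shows "Ck_on k (\<lambda>x. \<Sum>i\<in>I. f i x) S"
  using assms(2)
proof (induction I rule: infinite_finite_induct)
  case (insert i I)
  then show ?case using Ck_on_add[OF assms(1), of k "f i" "\<lambda>x. \<Sum>i\<in>I. f i x"] by simp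
qed (auto simp: Ck_on_const)

lemma Ck_on_bilinear:
  assumes "bounded_bilinear b" "open S" "Ck_on k f S" "Ck_on k g S"
  shows "Ck_on k (\<lambda>x. b (f x) (g x)) S"
  using assms(3,4)
proof (induction k arbitrary: f g)
  case 0
  then show ?case using bounded_bilinear.continuous_on[OF assms(1)] by simp
next
  case (Suc k)
  show ?case
  proof (rule Ck_on_SucI[OF assms(2)])
    show "((\<lambda>x. b (f x) (g x)) has_derivative
        (\<lambda>v. b (f x) (frechet_derivative g (at x) v) + b (frechet_derivative f (at x) v) (g x))) (at x)"
      if "x \<in> S" for x
      using Suc.prems that
      by (intro bounded_bilinear.FDERIV[OF assms(1)] Ck_on_Suc_has_derivative)
    show "Ck_on k (\<lambda>x. b (f x) (frechet_derivative g (at x) v)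
        + b (frechet_derivative f (at x) v) (g x)) S" for v
      \<comment> \<open>The product rule leaves one factor undifferentiated in each term; that
        factor is lowered from order \<open>Suc k\<close> to \<open>k\<close> to meet the induction
        hypothesis.\<close>
      using Suc.prems Ck_on_Suc_imp[OF Suc.prems(1)] Ck_on_Suc_imp[OF Suc.prems(2)]
      by (intro Ck_on_add[OF assms(2)] Suc.IH) auto
  qed
qed

text \<open>Both sides are linear in \<open>y\<close>, so generators suffice. A zero vector in
  \<open>C\<close> does no harm: its coefficient is \<open>0 / 0 = 0\<close>.\<close>

lemma orthogonal_expansion:
  fixes y :: "'a::real_inner"
  assumes "finite C" "pairwise orthogonal C" "y \<in> span C"
  shows "y = (\<Sum>c\<in>C. ((y \<bullet> c) / (c \<bullet> c)) *\<^sub>R c)"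
  using assms(3)
proof (induction rule: span_induct_alt)
  case base
  then show ?case by simp
next
  case (step r x y)
  have "(\<Sum>c\<in>C. ((x \<bullet> c) / (c \<bullet> c)) *\<^sub>R c) = (\<Sum>c\<in>C. if c = x then x else 0)"
    using assms(2) step(1) by (intro sum.cong) (auto simp: pairwise_def orthogonal_def)
  then have x: "(\<Sum>c\<in>C. ((x \<bullet> c) / (c \<bullet> c)) *\<^sub>R c) = x"
    using assms(1) step(1) by simp
  have "(\<Sum>c\<in>C. (((r *\<^sub>R x + y) \<bullet> c) / (c \<bullet> c)) *\<^sub>R c)
      = r *\<^sub>R (\<Sum>c\<in>C. ((x \<bullet> c) / (c \<bullet> c)) *\<^sub>R c) + (\<Sum>c\<in>C. ((y \<bullet> c) / (c \<bullet> c)) *\<^sub>R c)"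
    by (simp add: inner_add_left add_divide_distrib scaleR_add_left sum.distrib scaleR_sum_right)
  then show ?case using x step(2) by simp
qed

text \<open>
  Finite dimension of the middle space is used to expand \<open>D g (f x) (D f x v)\<close> in a basis, because
  the definition of \<open>C\<^sup>k\<close> speaks about derivatives in fixed directions only.
\<close>

lemma Ck_on_compose:
  fixes f :: "'a::real_normed_vector \<Rightarrow> 'b::real_inner"
    and g :: "'b \<Rightarrow> 'c::real_normed_vector"
  assumes fin: "\<exists>B::'b set. finite B \<and> span B = UNIV"
    and "open S" "f ` S \<subseteq> T" "Ck_on k f S" "Ck_on k g T"
  shows "Ck_on k (g \<circ> f) S"
  using assms(4,5)
proof (induction k arbitrary: g)
  case 0
  then have "continuous_on S f" "continuous_on T g" by simp_all
  then have "continuous_on S (g \<circ> f)"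
    by (intro continuous_on_compose continuous_on_subset[OF _ assms(3)])
  then show ?case by simp
next
  case (Suc k)
  obtain C :: "'b set" where C: "finite C" "span C = UNIV" "pairwise orthogonal C"
    using fin basis_orthogonal by metis
  show ?case
  proof (rule Ck_on_SucI[OF assms(2)])
    fix x assume x: "x \<in> S"
    define Df where "Df = frechet_derivative f (at x)"
    define Dg where "Dg = frechet_derivative g (at (f x))"
    have g': "(g has_derivative Dg) (at (f x))"
      using Suc.prems(2) assms(3) x unfolding Dg_def by (blast intro: Ck_on_Suc_has_derivative)
    have "(g \<circ> f has_derivative Dg \<circ> Df) (at x)"
      using diff_chain_at[OF Ck_on_Suc_has_derivative[OF Suc.prems(1) x] g'] by (simp add: Df_def)
    moreover have "Dg (Df v) = (\<Sum>c\<in>C. ((Df v \<bullet> c) / (c \<bullet> c)) *\<^sub>R Dg c)" for v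
    proof -
      have "linear Dg" using g' has_derivative_linear by blast
      then have "Dg (\<Sum>c\<in>C. ((Df v \<bullet> c) / (c \<bullet> c)) *\<^sub>R c)
          = (\<Sum>c\<in>C. ((Df v \<bullet> c) / (c \<bullet> c)) *\<^sub>R Dg c)"
        by (simp add: linear_sum linear_cmul)
      then show ?thesis
        using orthogonal_expansion[OF C(1,3), of "Df v"] C(2) by simp
    qed
    ultimately show "(g \<circ> f has_derivative (\<lambda>v. \<Sum>c\<in>C. ((frechet_derivative f (at x) v \<bullet> c) / (c \<bullet> c))
        *\<^sub>R frechet_derivative g (at (f x)) c)) (at x)"
      by (simp add: o_def Df_def Dg_def)
  next
    fix v
    show "Ck_on k (\<lambda>x. \<Sum>c\<in>C. ((frechet_derivative f (at x) v \<bullet> c) / (c \<bullet> c))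
        *\<^sub>R frechet_derivative g (at (f x)) c) S"
    proof (intro Ck_on_sum[OF assms(2)] Ck_on_bilinear[OF bounded_bilinear_scaleR assms(2)])
      fix c
      have "bounded_linear (\<lambda>y::'b. (y \<bullet> c) / (c \<bullet> c))"
        by (rule bounded_linear_compose[OF bounded_linear_divide bounded_linear_inner_left])
      then show "Ck_on k (\<lambda>x. (frechet_derivative f (at x) v \<bullet> c) / (c \<bullet> c)) S"
        by (rule Ck_on_bounded_linear) (use assms(2) Suc.prems in auto)
      \<comment> \<open>The direction \<open>c\<close> is now a constant, so the derivative of
        \<open>g\<close> along \<open>c\<close> is again a \<open>Ck_on k\<close> map and the
        induction hypothesis, general in \<open>g\<close>, applies to it.\<close>
      have "Ck_on k ((\<lambda>y. frechet_derivative g (at y) c) \<circ> f) S"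
        by (rule Suc.IH) (use Suc.prems Ck_on_Suc_imp[OF Suc.prems(1)] in auto)
      then show "Ck_on k (\<lambda>x. frechet_derivative g (at (f x)) c) S" by (simp add: o_def)
    qed
  qed
qed

lemma smooth_on_has_derivative:
  assumes "smooth_on f S" "x \<in> S"
  shows "(f has_derivative frechet_derivative f (at x)) (at x)"
  using assms Ck_on_Suc_has_derivative by (metis smooth_on_def)

lemma smooth_on_subset: "smooth_on f S \<Longrightarrow> T \<subseteq> S \<Longrightarrow> smooth_on f T"
  unfolding smooth_on_def using Ck_on_subset by blast

lemma smooth_on_cong:
  "open S \<Longrightarrow> smooth_on f S \<Longrightarrow> (\<And>x. x \<in> S \<Longrightarrow> f x = g x) \<Longrightarrow> smooth_on g S"
  unfolding smooth_on_def using Ck_on_cong by blast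

lemma smooth_on_local:
  "(\<And>x. x \<in> S \<Longrightarrow> \<exists>T. open T \<and> x \<in> T \<and> smooth_on f T) \<Longrightarrow> smooth_on f S"
  unfolding smooth_on_def using Ck_on_local by metis

lemma smooth_on_compose:
  fixes f :: "'a::real_normed_vector \<Rightarrow> 'b::real_inner"
    and g :: "'b \<Rightarrow> 'c::real_normed_vector"
  assumes "\<exists>B::'b set. finite B \<and> span B = UNIV"
    and "open S" "f ` S \<subseteq> T" "smooth_on f S" "smooth_on g T"
  shows "smooth_on (g \<circ> f) S"
  using Ck_on_compose[OF assms(1,2,3)] assms(4,5) by (auto simp: smooth_on_def)

section \<open>Smooth functions and tangent vectors on manifolds\<close>

context smooth_manifold
begin

section \<open>Charts and open sets\<close>

lemma chart_subset_topspace: "(U, \<phi>) \<in> A \<Longrightarrow> U \<subseteq> topspace M"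
  using chart_domain openin_subset by blast

lemma chart_inj_on:
  assumes "(U, \<phi>) \<in> A"
  shows "inj_on \<phi> U"
  using homeomorphic_imp_injective_map[OF chart_homeo[OF assms]] chart_subset_topspace[OF assms]
  by (simp add: Int_absorb1)

lemma inv_chart: "(U, \<phi>) \<in> A \<Longrightarrow> x \<in> U \<Longrightarrow> inv_into U \<phi> (\<phi> x) = x"
  using chart_inj_on by simp

lemma open_chart_image:
  assumes "(U, \<phi>) \<in> A" "openin M W"
  shows "open (\<phi> ` (U \<inter> W))"
proof -
  have "openin (subtopology M U) (U \<inter> W)"
    using assms(2) openin_subtopology_Int2 by blast
  then have "openin (top_of_set (\<phi> ` U)) (\<phi> ` (U \<inter> W))"
    using homeomorphic_map_openness_eq[OF chart_homeo[OF assms(1)]] by blast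
  then show ?thesis using chart_image[OF assms(1)] openin_open_trans by blast
qed

lemma openin_chart_vimage:
  assumes "(U, \<phi>) \<in> A" "open T"
  shows "openin M {x \<in> U. \<phi> x \<in> T}"
proof -
  have "continuous_map (subtopology M U) (top_of_set (\<phi> ` U)) \<phi>"
    using chart_homeo[OF assms(1)] homeomorphic_imp_continuous_map by blast
  then have "continuous_map (subtopology M U) euclidean \<phi>"
    by (simp add: continuous_map_in_subtopology)
  then have "openin (subtopology M U) {x \<in> topspace (subtopology M U). \<phi> x \<in> T}"
    using assms(2) openin_continuous_map_preimage by fastforce
  then show ?thesis
    using chart_domain[OF assms(1)] chart_subset_topspace[OF assms(1)]
    by (simp add: Int_absorb1 openin_open_subtopology)
qed

text \<open>One argument for sums, products and multiples: both functions are smooth on the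
  intersection of their neighbourhoods, and \<open>F\<close> is any pointwise operation that
  preserves \<open>Ck_on\<close>.\<close>

lemma smooth_near_combine:
  assumes g: "smooth_near M A x g" and h: "smooth_near M A x h"
    and F: "\<And>S k (u::'b \<Rightarrow> real) v.
      open S \<Longrightarrow> Ck_on k u S \<Longrightarrow> Ck_on k v S \<Longrightarrow> Ck_on k (\<lambda>z. F (u z) (v z)) S"
  shows "smooth_near M A x (\<lambda>y. F (g y) (h y))"
proof -
  obtain W where W: "x \<in> W" "smooth_function_on M A W g"
    using g by (auto simp: smooth_near_def)
  obtain W' where W': "x \<in> W'" "smooth_function_on M A W' h"
    using h by (auto simp: smooth_near_def)
  have op: "openin M (W \<inter> W')"
    using W W' by (auto simp: smooth_function_on_def)
  have "smooth_on ((\<lambda>y. F (g y) (h y)) \<circ> inv_into U \<phi>) (\<phi> ` (U \<inter> (W \<inter> W')))"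
    if c: "(U, \<phi>) \<in> A" for U \<phi>
  proof -
    have "smooth_on (g \<circ> inv_into U \<phi>) (\<phi> ` (U \<inter> (W \<inter> W')))"
      by (rule smooth_on_subset[where S = "\<phi> ` (U \<inter> W)"])
        (use W(2) c in \<open>auto simp: smooth_function_on_def\<close>)
    moreover have "smooth_on (h \<circ> inv_into U \<phi>) (\<phi> ` (U \<inter> (W \<inter> W')))"
      by (rule smooth_on_subset[where S = "\<phi> ` (U \<inter> W')"])
        (use W'(2) c in \<open>auto simp: smooth_function_on_def\<close>)
    ultimately show ?thesis
      using F[OF open_chart_image[OF c op]] by (simp add: smooth_on_def o_def)
  qed
  with op W(1) W'(1) show ?thesis
    unfolding smooth_near_def smooth_function_on_def by (intro exI[of _ "W \<inter> W'"]) auto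
qed

lemma smooth_near_add:
  "smooth_near M A x g \<Longrightarrow> smooth_near M A x h \<Longrightarrow> smooth_near M A x (\<lambda>y. g y + h y)"
  by (rule smooth_near_combine[where F = "(+)"]) (auto intro: Ck_on_add)

lemma smooth_near_mult:
  "smooth_near M A x g \<Longrightarrow> smooth_near M A x h \<Longrightarrow> smooth_near M A x (\<lambda>y. g y * h y)"
  by (rule smooth_near_combine[where F = "(*)"])
    (auto intro: Ck_on_bilinear[OF bounded_bilinear_mult])

lemma smooth_near_cmult: "smooth_near M A x g \<Longrightarrow> smooth_near M A x (\<lambda>y. c * g y)"
  by (rule smooth_near_combine[where F = "\<lambda>u v. c * u" and h = g])
    (auto intro: Ck_on_bounded_linear[OF bounded_linear_mult_right])

section \<open>Coordinate functions and coordinate derivations\<close>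

lemma smooth_near_chart_has_derivative:
  assumes c: "(U, \<phi>) \<in> A" and x: "x \<in> U" and g: "smooth_near M A x g"
  shows "(g \<circ> inv_into U \<phi> has_derivative frechet_derivative (g \<circ> inv_into U \<phi>) (at (\<phi> x)))
    (at (\<phi> x))"
proof -
  obtain W where "x \<in> W" "smooth_function_on M A W g"
    using g by (auto simp: smooth_near_def)
  with c x have "smooth_on (g \<circ> inv_into U \<phi>) (\<phi> ` (U \<inter> W))" "\<phi> x \<in> \<phi> ` (U \<inter> W)"
    by (auto simp: smooth_function_on_def)
  then show ?thesis by (rule smooth_on_has_derivative)
qed

text \<open>Components of a chart are the test functions that detect the derivative of a map. In
  another chart such a component is a transition map followed by a linear functional.\<close>

lemma smooth_near_chart_inner:
  assumes c: "(V, \<psi>) \<in> A" and y: "y \<in> V"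
  shows "smooth_near M A y (\<lambda>z. \<psi> z \<bullet> w)"
proof -
  have "smooth_on ((\<lambda>z. \<psi> z \<bullet> w) \<circ> inv_into U \<phi>) (\<phi> ` (U \<inter> V))" if "(U, \<phi>) \<in> A" for U \<phi>
    using charts_compatible[OF that c]
      Ck_on_bounded_linear[OF bounded_linear_inner_left[of w] open_chart_image[OF that chart_domain[OF c]]]
    by (simp add: smooth_on_def o_def)
  then have "smooth_function_on M A V (\<lambda>z. \<psi> z \<bullet> w)"
    using chart_domain[OF c] by (auto simp: smooth_function_on_def)
  with y show ?thesis unfolding smooth_near_def by (intro exI[of _ V] conjI)
qed

text \<open>The coordinate vector at \<open>x\<close> in direction \<open>v\<close>; the default
  \<open>0\<close> matches the convention in \<open>tangent_space\<close>.\<close>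

definition chart_derivation :: "'a set \<Rightarrow> ('a \<Rightarrow> 'b) \<Rightarrow> 'a \<Rightarrow> 'b \<Rightarrow> 'a tangent_vector" where
  "chart_derivation U \<phi> x v = (\<lambda>g. if smooth_near M A x g
     then frechet_derivative (g \<circ> inv_into U \<phi>) (at (\<phi> x)) v else 0)"

lemma chart_derivation_eq:
  assumes "smooth_near M A x g" "(g \<circ> inv_into U \<phi> has_derivative D) (at (\<phi> x))"
  shows "chart_derivation U \<phi> x v g = D v"
  using assms frechet_derivative_at[OF assms(2)] by (simp add: chart_derivation_def)

text \<open>The sum, product and scaling rules for Frechet derivatives are the derivation axioms;
  \<open>inv_chart\<close> turns values at \<open>\<phi> x\<close> in the chart into values at
  \<open>x\<close>.\<close>

lemma chart_derivation_tangent: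
  assumes c: "(U, \<phi>) \<in> A" and x: "x \<in> U"
  shows "chart_derivation U \<phi> x v \<in> tangent_space M A x"
proof -
  let ?X = "chart_derivation U \<phi> x v"
  let ?D = "\<lambda>g. frechet_derivative (g \<circ> inv_into U \<phi>) (at (\<phi> x))"
  note der = smooth_near_chart_has_derivative[OF c x, unfolded o_def]
  have X: "?X g = ?D g v" if "smooth_near M A x g" for g
    using that by (simp add: chart_derivation_def)
  have "?X (\<lambda>y. g y + h y) = ?X g + ?X h"
    if g: "smooth_near M A x g" and h: "smooth_near M A x h" for g h
    using chart_derivation_eq[OF smooth_near_add[OF g h], where U = U and \<phi> = \<phi> and D = "\<lambda>v. ?D g v + ?D h v"]
      has_derivative_add[OF der[OF g] der[OF h]] by (simp add: X g h o_def)
  moreover have "?X (\<lambda>y. g y * h y) = ?X g * h x + g x * ?X h"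
    if g: "smooth_near M A x g" and h: "smooth_near M A x h" for g h
    using chart_derivation_eq[OF smooth_near_mult[OF g h], where U = U and \<phi> = \<phi> and D = "\<lambda>v. g x * ?D h v + ?D g v * h x"]
      has_derivative_mult[OF der[OF g] der[OF h]] by (simp add: X g h o_def inv_chart[OF c x])
  moreover have "?X (\<lambda>y. a * g y) = a * ?X g" if g: "smooth_near M A x g" for a g
    using chart_derivation_eq[OF smooth_near_cmult[OF g], where U = U and \<phi> = \<phi> and D = "\<lambda>v. a * ?D g v"]
      has_derivative_mult_right[OF der[OF g]] by (simp add: X g o_def)
  moreover have "?X g = 0" if "\<not> smooth_near M A x g" for g
    using that by (simp add: chart_derivation_def)
  ultimately show ?thesis unfolding tangent_space_def by blast
qed

end

section \<open>Pullback of functions and push-forward of tangent vectors\<close>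

text \<open>Locally a target chart \<open>\<psi>\<close> can be inserted between \<open>g\<close>
  and \<open>f\<close>, and the chain rule applies to the two coordinate expressions. The chart
  depends on the point, hence the appeal to \<open>smooth_on_local\<close>.\<close>

lemma smooth_near_compose:
  assumes "smooth_manifold M A" "smooth_manifold N B"
    and f: "smooth_map M A N B f" and x: "x \<in> topspace M" and g: "smooth_near N B (f x) g"
  shows "smooth_near M A x (g \<circ> f)"
proof -
  interpret M: smooth_manifold M A by fact
  interpret N: smooth_manifold N B by fact
  have cont: "continuous_map M N f" using f by (simp add: smooth_map_def)
  obtain W where W: "f x \<in> W" "smooth_function_on N B W g"
    using g by (auto simp: smooth_near_def)
  define W' where "W' = {y \<in> topspace M. f y \<in> W}"
  have op: "openin M W'"
    using W(2) openin_continuous_map_preimage[OF cont] by (simp add: W'_def smooth_function_on_def)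
  have "smooth_on (g \<circ> f \<circ> inv_into U \<phi>) (\<phi> ` (U \<inter> W'))" if c: "(U, \<phi>) \<in> A" for U \<phi>
  proof (rule smooth_on_local)
    fix z assume "z \<in> \<phi> ` (U \<inter> W')"
    then obtain y where y: "y \<in> U" "y \<in> W'" "z = \<phi> y" by blast
    then have fy: "f y \<in> topspace N" using continuous_map_image_subset_topspace[OF cont]
      by (auto simp: W'_def)
    then obtain V \<psi> where V: "(V, \<psi>) \<in> B" "f y \<in> V"
      using N.charts_cover by blast
    \<comment> \<open>On \<open>W''\<close> the map \<open>f\<close> lands in both \<open>W\<close>
      and the single chart domain \<open>V\<close>, so \<open>inv_into V \<psi>\<close> really
      undoes \<open>\<psi>\<close> there.\<close>
    define W'' where "W'' = W' \<inter> {y \<in> topspace M. f y \<in> V}"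
    have op'': "openin M W''"
      using op openin_continuous_map_preimage[OF cont N.chart_domain[OF V(1)]]
      by (auto simp: W''_def)
    let ?T = "\<phi> ` (U \<inter> W'')"
    have "smooth_on (\<psi> \<circ> f \<circ> inv_into U \<phi>) (\<phi> ` (U \<inter> f -` V))"
      using f c V(1) by (auto simp: smooth_map_def)
    then have 1: "smooth_on (\<psi> \<circ> f \<circ> inv_into U \<phi>) ?T"
      by (rule smooth_on_subset) (auto simp: W''_def)
    have 2: "smooth_on (g \<circ> inv_into V \<psi>) (\<psi> ` (V \<inter> W))"
      using W(2) V(1) by (auto simp: smooth_function_on_def)
    have T: "open ?T" by (rule M.open_chart_image[OF c op''])
    have "smooth_on ((g \<circ> inv_into V \<psi>) \<circ> (\<psi> \<circ> f \<circ> inv_into U \<phi>)) ?T"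
      by (rule smooth_on_compose[OF N.finite_dimensional_model T _ 1 2])
        (auto simp: W'_def W''_def M.inv_chart[OF c])
    then have "smooth_on (g \<circ> f \<circ> inv_into U \<phi>) ?T"
      by (rule smooth_on_cong[OF T])
        (auto simp: W''_def M.inv_chart[OF c] N.inv_chart[OF V(1)])
    moreover have "z \<in> ?T" using y V(2) by (auto simp: W''_def W'_def)
    ultimately show "\<exists>T. open T \<and> z \<in> T \<and> smooth_on (g \<circ> f \<circ> inv_into U \<phi>) T"
      using T by blast
  qed
  with op have "smooth_function_on M A W' (g \<circ> f)" by (auto simp: smooth_function_on_def)
  moreover have "x \<in> W'" using W(1) x by (simp add: W'_def)
  ultimately show ?thesis unfolding smooth_near_def by (intro exI[of _ W'] conjI)
qed

text \<open>Needed because linearity of the endomorphism field on the target and its quadratic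
  identity are available on tangent vectors only.\<close>

lemma tangent_map_tangent:
  assumes M: "smooth_manifold M A" and N: "smooth_manifold N B"
    and f: "smooth_map M A N B f" and x: "x \<in> topspace M" and X: "X \<in> tangent_space M A x"
  shows "tangent_map N B f x X \<in> tangent_space N B (f x)"
proof -
  note pull = smooth_near_compose[OF M N f x]
  note cl = smooth_manifold.smooth_near_add[OF N] smooth_manifold.smooth_near_mult[OF N]
    smooth_manifold.smooth_near_cmult[OF N]
  have "tangent_map N B f x X (\<lambda>y. g y + h y)
      = tangent_map N B f x X g + tangent_map N B f x X h \<and>
      tangent_map N B f x X (\<lambda>y. g y * h y)
      = tangent_map N B f x X g * h (f x) + g (f x) * tangent_map N B f x X h"
    if g: "smooth_near N B (f x) g" and h: "smooth_near N B (f x) h" for g h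
    using X pull[OF g] pull[OF h] g h cl(1,2)[OF g h]
    by (simp add: tangent_map_def tangent_space_def o_def)
  moreover have "tangent_map N B f x X (\<lambda>y. c * g y) = c * tangent_map N B f x X g"
    if g: "smooth_near N B (f x) g" for c g
    using X pull[OF g] g cl(3)[OF g] by (simp add: tangent_map_def tangent_space_def o_def)
  moreover have "tangent_map N B f x X g = 0" if "\<not> smooth_near N B (f x) g" for g
    using that by (simp add: tangent_map_def)
  ultimately show ?thesis unfolding tangent_space_def by blast
qed

section \<open>Maps with vanishing tangent map\<close>

lemma tangent_map_zero_imp_constant:
  assumes "smooth_manifold M A" "smooth_manifold N B"
    and conn: "connected_space M" and f: "smooth_map M A N B f"
    and zero: "\<And>x X g. x \<in> topspace M \<Longrightarrow> X \<in> tangent_space M A x \<Longrightarrow> tangent_map N B f x X g = 0"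
  shows "f constant_on topspace M"
proof -
  interpret M: smooth_manifold M A by fact
  interpret N: smooth_manifold N B by fact
  have cont: "continuous_map M N f" using f by (simp add: smooth_map_def)
  have loc: "\<exists>T. openin M T \<and> x \<in> T \<and> (\<forall>y\<in>T. f y = f x)" if x: "x \<in> topspace M" for x
  proof -
    obtain U \<phi> where U: "(U, \<phi>) \<in> A" "x \<in> U"
      using M.charts_cover x by blast
    have "f x \<in> topspace N" using continuous_map_image_subset_topspace[OF cont] x by blast
    then obtain V \<psi> where V: "(V, \<psi>) \<in> B" "f x \<in> V"
      using N.charts_cover by blast
    define h where "h = \<psi> \<circ> f \<circ> inv_into U \<phi>"
    define S where "S = \<phi> ` (U \<inter> f -` V)"
    have Ueq: "U \<inter> f -` V = U \<inter> {y \<in> topspace M. f y \<in> V}"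
      using M.chart_subset_topspace[OF U(1)] by blast
    have S: "open S"
      unfolding S_def Ueq
      by (rule M.open_chart_image[OF U(1) openin_continuous_map_preimage[OF cont N.chart_domain[OF V(1)]]])
    have smooth: "smooth_on h S"
      using f U(1) V(1) by (auto simp: smooth_map_def h_def S_def)
    have h': "(h has_derivative (\<lambda>v. 0)) (at z)" if z: "z \<in> S" for z
    proof -
      obtain y where y: "y \<in> U" "f y \<in> V" "z = \<phi> y" using z S_def by blast
      let ?D = "frechet_derivative h (at z)"
      have D: "(h has_derivative ?D) (at z)" by (rule smooth_on_has_derivative[OF smooth z])
      have yM: "y \<in> topspace M" using y(1) M.chart_subset_topspace[OF U(1)] by blast
      have "?D v \<bullet> w = 0" for v w
      proof -
        let ?g = "\<lambda>u. \<psi> u \<bullet> w"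
        have g: "smooth_near N B (f y) ?g" by (rule N.smooth_near_chart_inner[OF V(1) y(2)])
        have "(?g \<circ> f \<circ> inv_into U \<phi> has_derivative (\<lambda>v. ?D v \<bullet> w)) (at (\<phi> y))"
          using has_derivative_inner_left[OF D, of w] by (simp add: h_def o_def y(3))
        then have "M.chart_derivation U \<phi> y v (?g \<circ> f) = ?D v \<bullet> w"
          by (rule M.chart_derivation_eq[OF smooth_near_compose[OF assms(1,2) f yM g]])
        moreover have "tangent_map N B f y (M.chart_derivation U \<phi> y v) ?g = 0"
          by (rule zero[OF yM M.chart_derivation_tangent[OF U(1) y(1)]])
        ultimately show ?thesis using g by (simp add: tangent_map_def)
      qed
      \<comment> \<open>Take \<open>w = ?D v\<close>.\<close>
      then have "?D = (\<lambda>v. 0)" by (metis inner_eq_zero_iff)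
      with D show ?thesis by simp
    qed
    have xS: "\<phi> x \<in> S" using U(2) V(2) S_def by blast
    then obtain e where e: "e > 0" "ball (\<phi> x) e \<subseteq> S" using S open_contains_ball by blast
    let ?T = "{y \<in> U. \<phi> y \<in> ball (\<phi> x) e}"
    have "f y = f x" if y: "y \<in> ?T" for y
    proof -
      \<comment> \<open>A ball is convex, so a zero derivative forces \<open>h\<close> to be
        constant on it.\<close>
      have "h (\<phi> y) = h (\<phi> x)"
        by (rule has_derivative_zero_unique[of "ball (\<phi> x) e"])
          (use y e in \<open>auto intro!: has_derivative_at_withinI[OF h']\<close>)
      then have "\<psi> (f y) = \<psi> (f x)" using y U by (simp add: h_def M.inv_chart)
      \<comment> \<open>Injectivity of \<open>\<psi>\<close> is known on \<open>V\<close> only.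
        Membership in \<open>S\<close> gives a point \<open>y'\<close> of \<open>U\<close> with the
        same coordinates and \<open>f y'\<close> in \<open>V\<close>; injectivity of
        \<open>\<phi>\<close> yields \<open>y = y'\<close>.\<close>
      moreover have "f y \<in> V"
      proof -
        obtain y' where "y' \<in> U" "f y' \<in> V" "\<phi> y = \<phi> y'" using y e(2) S_def by blast
        then show ?thesis using y M.chart_inj_on[OF U(1)] by (auto dest: inj_onD)
      qed
      ultimately show ?thesis using V N.chart_inj_on[OF V(1)] by (auto dest: inj_onD)
    qed
    moreover have "openin M ?T" by (rule M.openin_chart_vimage[OF U(1)]) simp
    moreover have "x \<in> ?T" using U(2) e(1) by simp
    ultimately show ?thesis by (intro exI[of _ ?T]) blast
  qed
  show ?thesis
  proof (cases "topspace M = {}")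
    case False
    then obtain a where a: "a \<in> topspace M" by blast
    let ?E = "{x \<in> topspace M. f x = f a}"
    \<comment> \<open>For a locally constant map every preimage is open; the cases
      \<open>{f a}\<close> and its complement make the fibre through \<open>a\<close>
      clopen.\<close>
    have op: "openin M {x \<in> topspace M. f x \<in> P}" for P
    proof (subst openin_subopen, intro ballI)
      fix x assume x: "x \<in> {x \<in> topspace M. f x \<in> P}"
      then obtain T where T: "openin M T" "x \<in> T" "\<forall>y\<in>T. f y = f x"
        using loc by blast
      moreover have "T \<subseteq> {x \<in> topspace M. f x \<in> P}"
        using x T(3) openin_subset[OF T(1)] by auto
      ultimately show "\<exists>T. openin M T \<and> x \<in> T \<and> T \<subseteq> {x \<in> topspace M. f x \<in> P}"
        by blast
    qed
    have "topspace M - ?E = {x \<in> topspace M. f x \<in> - {f a}}" by blast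
    then have "closedin M ?E" using op[of "- {f a}"] by (auto simp: closedin_def)
    moreover have "openin M ?E" using op[of "{f a}"] by simp
    ultimately have "?E = {} \<or> ?E = topspace M"
      using conn connected_space_clopen_in by blast
    then show ?thesis using a unfolding constant_on_def by blast
  qed (simp add: constant_on_def)
qed

section \<open>Metallic maps\<close>

text \<open>The image of \<open>J x (J x X)\<close> is computed twice, once with each quadratic
  identity, which eliminates the second-order term. Evaluating at \<open>g\<close> gives a scalar
  equation that covers both cases of the theorem.\<close>

lemma metallic_map_relation:
  assumes M: "metallic_manifold M A J p q" and N: "metallic_manifold N B K p' q'"
    and f: "metallic_map M A J N B K f" and x: "x \<in> topspace M" and X: "X \<in> tangent_space M A x"
  shows "(p - p') * K (f x) (tangent_map N B f x X) g = (q' - q) * tangent_map N B f x X g"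
proof -
  let ?Y = "tangent_map N B f x X"
  have sm: "smooth_manifold M A" "smooth_manifold N B" "smooth_map M A N B f"
    using M N f by (auto simp: metallic_manifold_def metallic_map_def)
  then have "continuous_map M N f" by (simp add: smooth_map_def)
  then have fx: "f x \<in> topspace N" using x continuous_map_image_subset_topspace by blast
  \<comment> \<open>Commutation is assumed for tangent vectors only, and it is used a second time at
    \<open>J x X\<close>.\<close>
  have JX: "J x X \<in> tangent_space M A x"
    using M x X by (auto simp: metallic_manifold_def smooth_endomorphism_field_def)
  have comm: "tangent_map N B f x (J x Z) = K (f x) (tangent_map N B f x Z)"
    if "Z \<in> tangent_space M A x" for Z
    using f x that by (auto simp: metallic_map_def)
  have "tangent_map N B f x (J x (J x X)) = K (f x) (K (f x) ?Y)"
    using comm[OF JX] comm[OF X] by simp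
  also have "\<dots> = (\<lambda>g. p' * K (f x) ?Y g + q' * ?Y g)"
    using N fx tangent_map_tangent[OF sm x X] by (auto simp: metallic_manifold_def)
  finally have "tangent_map N B f x (J x (J x X)) g = p' * K (f x) ?Y g + q' * ?Y g"
    by simp
  moreover have "J x (J x X) = (\<lambda>g. p * J x X g + q * X g)"
    using M x X by (auto simp: metallic_manifold_def)
  then have "tangent_map N B f x (J x (J x X)) g = p * tangent_map N B f x (J x X) g + q * ?Y g"
    by (simp add: tangent_map_def)
  ultimately show ?thesis using comm[OF X] by (simp add: algebra_simps)
qed

text \<open>Applying the quadratic identity to an eigenvector gives a multiple of \<open>Y\<close>;
  a single function \<open>g\<close> with \<open>Y g\<close> nonzero suffices to cancel it.\<close>

lemma metallic_eigenvalue: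
  assumes N: "metallic_manifold N B K p q" and y: "y \<in> topspace N"
    and Y: "Y \<in> tangent_space N B y" and eig: "K y Y = (\<lambda>g. l * Y g)" and nz: "Y g \<noteq> 0"
  shows "l\<^sup>2 = p * l + q"
proof -
  have lin: "K y (\<lambda>g. a * Z g + b * Z' g) = (\<lambda>g. a * K y Z g + b * K y Z' g)"
    if "Z \<in> tangent_space N B y" "Z' \<in> tangent_space N B y" for Z Z' a b
    using N y that by (simp add: metallic_manifold_def smooth_endomorphism_field_def)
  have "K y (K y Y) = (\<lambda>g. p * K y Y g + q * Y g)"
    using N y Y by (simp add: metallic_manifold_def)
  \<comment> \<open>Homogeneity is the two-term linearity axiom with second coefficient
    \<open>0\<close>.\<close>
  moreover have "K y (\<lambda>g. l * Y g) = (\<lambda>g. l * K y Y g)"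
    using lin[OF Y Y, of l 0] by simp
  ultimately have "l * (l * Y g) = p * (l * Y g) + q * Y g"
    unfolding eig by metis
  then have "(l\<^sup>2 - (p * l + q)) * Y g = 0" by (simp add: algebra_simps power2_eq_square)
  then show ?thesis using nz by simp
qed

text \<open>Completing the square makes \<open>2 * l - p\<close> a square root of the discriminant,
  and complex square roots agree up to sign. Its contrapositive turns the complex hypothesis of the
  theorem into a real inequation.\<close>

lemma quadratic_root_csqrt:
  fixes l p q :: real
  assumes "l\<^sup>2 = p * l + q"
  shows "complex_of_real l = (complex_of_real p + csqrt (complex_of_real (p\<^sup>2 + 4 * q))) / 2 \<or>
    complex_of_real l = (complex_of_real p - csqrt (complex_of_real (p\<^sup>2 + 4 * q))) / 2"
proof -
  have "(2 * l - p)\<^sup>2 = p\<^sup>2 + 4 * q"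
    using assms by (simp add: power2_eq_square algebra_simps)
  then have "(complex_of_real (2 * l - p))\<^sup>2 = (csqrt (complex_of_real (p\<^sup>2 + 4 * q)))\<^sup>2"
    by (metis of_real_power power2_csqrt)
  then have "complex_of_real (2 * l - p) = csqrt (complex_of_real (p\<^sup>2 + 4 * q)) \<or>
      complex_of_real (2 * l - p) = - csqrt (complex_of_real (p\<^sup>2 + 4 * q))"
    by (simp only: power2_eq_iff)
  then show ?thesis by (auto simp: field_simps)
qed

theorem proposition5p1:
  fixes M1 :: "'a topology" and A1 :: "('a, 'b::real_inner) chart set"
    and J1 :: "'a \<Rightarrow> 'a tangent_vector \<Rightarrow> 'a tangent_vector"
    and M2 :: "'c topology" and A2 :: "('c, 'd::real_inner) chart set"
    and J2 :: "'c \<Rightarrow> 'c tangent_vector \<Rightarrow> 'c tangent_vector"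
    and p1 q1 p2 q2 :: real and f :: "'a \<Rightarrow> 'c"
  assumes "metallic_manifold M1 A1 J1 p1 q1" and "connected_space M1"
    and "metallic_manifold M2 A2 J2 p2 q2" and "connected_space M2"
    and "metallic_map M1 A1 J1 M2 A2 J2 f"
  shows "(p1 \<noteq> p2 \<and>
          complex_of_real ((q1 - q2) / (p2 - p1))
            \<noteq> (complex_of_real p2 + csqrt (complex_of_real (p2\<^sup>2 + 4 * q2))) / 2 \<and>
          complex_of_real ((q1 - q2) / (p2 - p1))
            \<noteq> (complex_of_real p2 - csqrt (complex_of_real (p2\<^sup>2 + 4 * q2))) / 2
          \<longrightarrow> f constant_on topspace M1) \<and>
         (p1 = p2 \<and> q1 \<noteq> q2 \<longrightarrow> f constant_on topspace M1)"
proof -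
  note M1 = assms(1) and M2 = assms(3) and f = assms(5)
  have sm: "smooth_manifold M1 A1" "smooth_manifold M2 A2" "smooth_map M1 A1 M2 A2 f"
    using M1 M2 f by (auto simp: metallic_manifold_def metallic_map_def)
  note const = tangent_map_zero_imp_constant[OF sm(1,2) assms(2) sm(3)]
  note rel = metallic_map_relation[OF M1 M2 f]
  let ?l = "(q1 - q2) / (p2 - p1)"
  \<comment> \<open>Dividing the relation by \<open>p1 - p2\<close> shows that \<open>?l\<close> is
    the only possible eigenvalue on images of tangent vectors.\<close>
  have "f constant_on topspace M1" if p: "p1 \<noteq> p2" and root: "?l\<^sup>2 \<noteq> p2 * ?l + q2"
  proof (rule const, rule ccontr)
    fix x X g
    assume x: "x \<in> topspace M1" and X: "X \<in> tangent_space M1 A1 x"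
      and nz: "tangent_map M2 A2 f x X g \<noteq> 0"
    have "J2 (f x) (tangent_map M2 A2 f x X) = (\<lambda>g. ?l * tangent_map M2 A2 f x X g)"
    proof
      fix g
      show "J2 (f x) (tangent_map M2 A2 f x X) g = ?l * tangent_map M2 A2 f x X g"
        using rel[OF x X, of g] p by (simp add: field_simps)
    qed
    moreover have "f x \<in> topspace M2"
      using sm(3) x by (auto simp: smooth_map_def dest: continuous_map_image_subset_topspace)
    ultimately show False
      using metallic_eigenvalue[OF M2 _ tangent_map_tangent[OF sm x X], where l = ?l, OF _ _ nz]
        root by simp
  qed
  moreover have "f constant_on topspace M1" if "p1 = p2" "q1 \<noteq> q2"
    \<comment> \<open>With equal linear coefficients the left side of \<open>rel\<close> vanishes,
      leaving a nonzero multiple of the image vector equal to \<open>0\<close>.\<close>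
    by (rule const) (use rel that in force)
  ultimately show ?thesis using quadratic_root_csqrt[of ?l p2 q2] by blast
qed

end
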